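(* Let $Q_8 = \langle r,s \mid r^4=1,\; s^2=r^2,\; s^{-1}rs = r^{-1} \rangle$ be the quaternion group. The only faithful hull spectrum of $Q_8$ is $\Pi_4$, and the maximal hull spectrum of $Q_8$ is also $\Pi_4$.
   Context: For a set $S$ of $m\times m$ complex matrices (or linear operators on a finite-dimensional complex vector space), $\mathrm{Co}(S)$ denotes the set of all (finite) convex combinations of elements of $S$, and the hull spectrum $\mathrm{HS}(S)\subseteq\mathbb{C}$ is the set of all complex numbers that occur as eigenvalues of some element of $\mathrm{Co}(S)$. $\Pi_4$ denotes the convex hull in $\mathbb{C}$ of the fourth roots of unity. The faithful hull spectra of a group $\mathcal{G}$ are the sets $\mathrm{HS}(\rho(\mathcal{G}))$ for faithful finite-dimensional complex representations $\rho$ of $\mathcal{G}$, where $\rho(\mathcal{G})$ is the image of $\rho$. The maximal hull spectrum of a finite group $\mathcal{G}$ is $\mathrm{HS}(\rho_{\mathrm{reg}}(\mathcal{G}))$, where $\rho_{\mathrm{reg}}$ is the left regular representation of $\mathcal{G}$ on the space of functions $\mathcal{G}\to\mathbb{C}$, $(\rho_{\mathrm{reg}}(g)f)(g')=f(g^{-1}g')$. *)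

theory Defs
  imports
    "HOL-Analysis.Convex"
    "HOL-Algebra.Group"
    "Jordan_Normal_Form.Char_Poly"
begin

section \<open>Groups given by generators and relations\<close>

text \<open>A word is a list of letters; the letter \<open>(a, True)\<close> stands for the generator \<open>a\<close> and
  \<open>(a, False)\<close> for its formal inverse.\<close>

type_synonym 'g gword = "('g \<times> bool) list"

text \<open>The congruence on words generated by free cancellation and the relations \<open>R\<close>,
  where a pair \<open>(u, v)\<close> in \<open>R\<close> encodes the relation \<open>u = v\<close>.\<close>

inductive_set pres_cong :: "('g gword \<times> 'g gword) set \<Rightarrow> ('g gword \<times> 'g gword) set"
  for R :: "('g gword \<times> 'g gword) set" where
  relation: "(u, v) \<in> R \<Longrightarrow> (u, v) \<in> pres_cong R"
| cancel: "([(a, e), (a, \<not> e)], []) \<in> pres_cong R"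
| refl: "(u, u) \<in> pres_cong R"
| sym: "(u, v) \<in> pres_cong R \<Longrightarrow> (v, u) \<in> pres_cong R"
| trans: "(u, v) \<in> pres_cong R \<Longrightarrow> (v, w) \<in> pres_cong R \<Longrightarrow> (u, w) \<in> pres_cong R"
| append: "(u, v) \<in> pres_cong R \<Longrightarrow> (u', v') \<in> pres_cong R \<Longrightarrow> (u @ u', v @ v') \<in> pres_cong R"

definition presented_group :: "('g gword \<times> 'g gword) set \<Rightarrow> 'g gword set monoid" where
  "presented_group R =
    \<lparr>carrier = UNIV // pres_cong R,
     mult = (\<lambda>A B. \<Union>u\<in>A. \<Union>v\<in>B. pres_cong R `` {u @ v}),
     one = pres_cong R `` {[]}\<rparr>"

lemma equiv_pres_cong: "equiv UNIV (pres_cong R)"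
  by (intro equivI refl_onI symI transI subset_UNIV)
    (auto intro: pres_cong.refl pres_cong.sym pres_cong.trans)

lemma presented_group_mult_class:
  "pres_cong R `` {u} \<otimes>\<^bsub>presented_group R\<^esub> pres_cong R `` {v} = pres_cong R `` {u @ v}"
proof -
  have "congruent2 (pres_cong R) (pres_cong R) (\<lambda>u v. pres_cong R `` {u @ v})"
    by (auto simp: congruent2_def intro!: equiv_class_eq[OF equiv_pres_cong] pres_cong.append)
  then show ?thesis
    by (simp add: presented_group_def UN_equiv_class2[OF equiv_pres_cong equiv_pres_cong])
qed

lemma word_left_inverse: "\<exists>v. (v @ u, []) \<in> pres_cong R"
proof (induction u)
  case Nil
  show ?case by (auto intro: pres_cong.refl exI[of _ "[]"])
next
  case (Cons x u)
  obtain a e where x: "x = (a, e)" by (cases x)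
  from Cons obtain v where v: "(v @ u, []) \<in> pres_cong R" by blast
  have "([(a, \<not> e), (a, e)], []) \<in> pres_cong R"
    using pres_cong.cancel[of a "\<not> e"] by simp
  then have "(v @ [(a, \<not> e), (a, e)] @ u, v @ [] @ u) \<in> pres_cong R"
    by (intro pres_cong.append pres_cong.refl)
  then have "((v @ [(a, \<not> e)]) @ x # u, []) \<in> pres_cong R"
    using v x by (auto intro: pres_cong.trans)
  then show ?case by blast
qed

lemma group_presented_group: "group (presented_group R)"
proof (rule groupI)
  let ?G = "presented_group R" and ?c = "\<lambda>u. pres_cong R `` {u}"
  have car: "A \<in> carrier ?G \<longleftrightarrow> (\<exists>u. A = ?c u)" for A
    by (auto simp: presented_group_def quotient_def)
  have one: "\<one>\<^bsub>?G\<^esub> = ?c []"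
    by (simp add: presented_group_def)
  show "\<one>\<^bsub>?G\<^esub> \<in> carrier ?G"
    using car one by blast
  show "A \<otimes>\<^bsub>?G\<^esub> B \<in> carrier ?G" if "A \<in> carrier ?G" "B \<in> carrier ?G" for A B
    using that by (metis car presented_group_mult_class)
  show "A \<otimes>\<^bsub>?G\<^esub> B \<otimes>\<^bsub>?G\<^esub> C = A \<otimes>\<^bsub>?G\<^esub> (B \<otimes>\<^bsub>?G\<^esub> C)"
    if "A \<in> carrier ?G" "B \<in> carrier ?G" "C \<in> carrier ?G" for A B C
    using that by (auto simp: car presented_group_mult_class)
  show "\<one>\<^bsub>?G\<^esub> \<otimes>\<^bsub>?G\<^esub> A = A" if "A \<in> carrier ?G" for A
    using that by (auto simp: car one presented_group_mult_class)
  show "\<exists>B\<in>carrier ?G. B \<otimes>\<^bsub>?G\<^esub> A = \<one>\<^bsub>?G\<^esub>" if A: "A \<in> carrier ?G" for A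
  proof -
    obtain u where u: "A = ?c u" using A car by blast
    obtain v where "(v @ u, []) \<in> pres_cong R" using word_left_inverse by blast
    then have "?c v \<otimes>\<^bsub>?G\<^esub> A = \<one>\<^bsub>?G\<^esub>"
      unfolding u one presented_group_mult_class by (rule equiv_class_eq[OF equiv_pres_cong])
    then show ?thesis using car by blast
  qed
qed

datatype Q8_gen = Gen_r | Gen_s

definition Q8 :: "Q8_gen gword set monoid" where
  "Q8 =
    (let r = (Gen_r, True); r' = (Gen_r, False); s = (Gen_s, True); s' = (Gen_s, False)
     in presented_group {([r, r, r, r], []), ([s, s], [r, r]), ([s', r, s], [r'])})"

section \<open>Hull spectra of sets of matrices\<close>

text \<open>Matrices of unspecified size form no vector space type, so the combination
  \<open>\<Sum>A\<in>F. c A \<cdot> A\<close> of \<open>n \<times> n\<close> matrices is written out entrywise.\<close>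

definition mat_Co :: "nat \<Rightarrow> complex mat set \<Rightarrow> complex mat set" where
  "mat_Co n S =
    {mat n n (\<lambda>ij. \<Sum>A\<in>F. complex_of_real (c A) * A $$ ij) | F c.
      finite F \<and> F \<subseteq> S \<and> (\<forall>A\<in>F. 0 \<le> c A) \<and> sum c F = 1}"

definition mat_HS :: "nat \<Rightarrow> complex mat set \<Rightarrow> complex set" where
  "mat_HS n S = {z. \<exists>A\<in>mat_Co n S. eigenvalue A z}"

definition GL :: "nat \<Rightarrow> complex mat monoid" where
  "GL n = units_of (ring_mat TYPE(complex) n ())"

definition faithful_rep :: "('a, 'b) monoid_scheme \<Rightarrow> nat \<Rightarrow> ('a \<Rightarrow> complex mat) \<Rightarrow> bool" where
  "faithful_rep G n \<rho> \<longleftrightarrow> \<rho> \<in> hom G (GL n) \<and> inj_on \<rho> (carrier G)"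

definition faithful_hull_spectra :: "('a, 'b) monoid_scheme \<Rightarrow> complex set set" where
  "faithful_hull_spectra G = {mat_HS n (\<rho> ` carrier G) | n \<rho>. faithful_rep G n \<rho>}"

section \<open>Hull spectra of sets of operators on a function space\<close>

text \<open>Functions \<open>X \<rightarrow> \<complex>\<close> are represented by functions on the whole type vanishing outside \<open>X\<close>.\<close>

definition fun_space :: "'a set \<Rightarrow> ('a \<Rightarrow> complex) set" where
  "fun_space X = {f. \<forall>x. x \<notin> X \<longrightarrow> f x = 0}"

type_synonym 'a fun_op = "('a \<Rightarrow> complex) \<Rightarrow> ('a \<Rightarrow> complex)"

definition op_Co :: "'a fun_op set \<Rightarrow> 'a fun_op set" where
  "op_Co S =
    {(\<lambda>f x. \<Sum>T\<in>F. complex_of_real (c T) * T f x) | F c.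
      finite F \<and> F \<subseteq> S \<and> (\<forall>T\<in>F. 0 \<le> c T) \<and> sum c F = 1}"

definition op_eigenvalue :: "'a set \<Rightarrow> 'a fun_op \<Rightarrow> complex \<Rightarrow> bool" where
  "op_eigenvalue X T z \<longleftrightarrow> (\<exists>f\<in>fun_space X. f \<noteq> (\<lambda>x. 0) \<and> T f = (\<lambda>x. z * f x))"

definition op_HS :: "'a set \<Rightarrow> 'a fun_op set \<Rightarrow> complex set" where
  "op_HS X S = {z. \<exists>T\<in>op_Co S. op_eigenvalue X T z}"

definition regular_rep :: "('a, 'b) monoid_scheme \<Rightarrow> 'a \<Rightarrow> 'a fun_op" where
  "regular_rep G g f = (\<lambda>x. if x \<in> carrier G then f (inv\<^bsub>G\<^esub> g \<otimes>\<^bsub>G\<^esub> x) else 0)"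

definition maximal_hull_spectrum :: "('a, 'b) monoid_scheme \<Rightarrow> complex set" where
  "maximal_hull_spectrum G = op_HS (carrier G) (regular_rep G ` carrier G)"

definition Pi_polygon :: "nat \<Rightarrow> complex set" where
  "Pi_polygon n = convex hull {z. z ^ n = 1}"

end

theory Submission
  imports Defs
begin

text \<open>If \<open>v\<close> is an eigenvector of \<open>\<Sum>h. d h * \<rho> h\<close> for \<open>z\<close>, then a nonzero coordinate function
  \<open>f g = (\<rho> g v)\<^sub>i\<close> satisfies \<open>(\<Sum>h. d h * f (g h)) = z * f g\<close>, a system of eight scalar equations. The
  part of \<open>f\<close> that is odd under the central element \<open>r\<^sup>2\<close> forces \<open>z\<close> to be an eigenvalue
  \<open>a \<plusminus> \<i> sqrt (b\<^sup>2 + c\<^sup>2 + e\<^sup>2)\<close> of the quaternion \<open>a + b i + c j + e k\<close> with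
  \<open>\<bar>a\<bar> + \<bar>b\<bar> + \<bar>c\<bar> + \<bar>e\<bar> \<le> 1\<close>; the even part forces \<open>z \<in> [-1, 1]\<close>. Conversely, in a faithful
  representation \<open>\<rho> r\<close> has a primitive fourth root of unity as an eigenvalue, so convex
  combinations of the powers of \<open>r\<close> already give all of the square.\<close>

section \<open>Homomorphisms out of a presented group\<close>

definition word_eval :: "('b, 'c) monoid_scheme \<Rightarrow> ('g \<Rightarrow> 'b) \<Rightarrow> 'g gword \<Rightarrow> 'b" where
  "word_eval H h w =
    foldr (\<lambda>(a, e) x. (if e then h a else inv\<^bsub>H\<^esub> h a) \<otimes>\<^bsub>H\<^esub> x) w \<one>\<^bsub>H\<^esub>"

lemma word_eval_simps [simp]:
  "word_eval H h [] = \<one>\<^bsub>H\<^esub>"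
  "word_eval H h ((a, e) # w) = (if e then h a else inv\<^bsub>H\<^esub> h a) \<otimes>\<^bsub>H\<^esub> word_eval H h w"
  by (simp_all add: word_eval_def)

context group
begin

lemma word_eval_closed [simp]:
  assumes "range h \<subseteq> carrier G"
  shows "word_eval G h w \<in> carrier G"
proof (induction w)
  case (Cons x w)
  have "h a \<in> carrier G" for a using assms by blast
  with Cons show ?case by (cases x) auto
qed simp

lemma word_eval_append:
  assumes "range h \<subseteq> carrier G"
  shows "word_eval G h (u @ v) = word_eval G h u \<otimes> word_eval G h v"
proof (induction u)
  case (Cons x u)
  have "h a \<in> carrier G" for a using assms by blast
  with Cons assms show ?case by (cases x) (auto simp: m_assoc)
qed (simp add: assms)

text \<open>The congruence is generated inductively from the relations and the cancellations, so it
  suffices that evaluation respects each rule.\<close>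

lemma word_eval_pres_cong:
  assumes "range h \<subseteq> carrier G"
    and rel: "\<And>u v. (u, v) \<in> R \<Longrightarrow> word_eval G h u = word_eval G h v"
    and "(u, v) \<in> pres_cong R"
  shows "word_eval G h u = word_eval G h v"
  using assms(3)
proof (induction rule: pres_cong.induct)
  case (cancel a e)
  have "h a \<in> carrier G" using assms(1) by blast
  then show ?case by simp
qed (simp_all add: rel word_eval_append assms(1))

text \<open>Von Dyck's theorem. It serves to separate the elements of \<open>Q8\<close> by mapping
  them to matrices.\<close>

lemma presented_group_hom:
  assumes h: "range h \<subseteq> carrier G"
    and rel: "\<And>u v. (u, v) \<in> R \<Longrightarrow> word_eval G h u = word_eval G h v"
  obtains \<phi> where "\<phi> \<in> hom (presented_group R) G"
    and "\<And>u. \<phi> (pres_cong R `` {u}) = word_eval G h u"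
proof -
  \<comment> \<open>Any word of the class may serve, since congruent words have equal
    values.\<close>
  define \<phi> where "\<phi> A = word_eval G h (SOME u. u \<in> A)" for A
  have val: "\<phi> (pres_cong R `` {u}) = word_eval G h u" for u
  proof -
    have "u \<in> pres_cong R `` {u}" by (simp add: pres_cong.refl)
    then have "(SOME v. v \<in> pres_cong R `` {u}) \<in> pres_cong R `` {u}" by (rule someI)
    then show ?thesis
      using word_eval_pres_cong[OF h rel, where u = u] by (auto simp: \<phi>_def)
  qed
  have "\<phi> \<in> hom (presented_group R) G"
  proof (rule homI)
    fix A B assume "A \<in> carrier (presented_group R)" "B \<in> carrier (presented_group R)"
    then obtain u v where uv: "A = pres_cong R `` {u}" "B = pres_cong R `` {v}"
      by (auto simp: presented_group_def quotient_def)
    then show "\<phi> A \<in> carrier G" using h by (simp add: val)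
    show "\<phi> (A \<otimes>\<^bsub>presented_group R\<^esub> B) = \<phi> A \<otimes> \<phi> B"
      using h by (simp add: uv presented_group_mult_class val word_eval_append)
  qed
  with val show thesis using that by blast
qed

end

section \<open>Eigenvalues of convex combinations\<close>

text \<open>The inequality describes the unit ball of the l1 norm. It is convex and contains the
  roots of unity; conversely, each of its points gets explicit weights on the four vertices.\<close>

lemma Pi_polygon_4_iff: "z \<in> Pi_polygon 4 \<longleftrightarrow> \<bar>Re z\<bar> + \<bar>Im z\<bar> \<le> 1"
proof
  have "convex {z. \<bar>Re z\<bar> + \<bar>Im z\<bar> \<le> 1}"
  proof (rule convexI, clarsimp)
    fix x y :: complex and u v :: real
    assume x: "\<bar>Re x\<bar> + \<bar>Im x\<bar> \<le> 1" and y: "\<bar>Re y\<bar> + \<bar>Im y\<bar> \<le> 1"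
      and uv: "0 \<le> u" "0 \<le> v" "u + v = 1"
    have "\<bar>u * Re x + v * Re y\<bar> + \<bar>u * Im x + v * Im y\<bar>
        \<le> (u * \<bar>Re x\<bar> + v * \<bar>Re y\<bar>) + (u * \<bar>Im x\<bar> + v * \<bar>Im y\<bar>)"
      using uv by (intro add_mono order.trans[OF abs_triangle_ineq]) (simp_all add: abs_mult)
    also have "\<dots> = u * (\<bar>Re x\<bar> + \<bar>Im x\<bar>) + v * (\<bar>Re y\<bar> + \<bar>Im y\<bar>)"
      by (simp add: algebra_simps)
    also have "\<dots> \<le> 1"
      using convex_bound_le[OF x y] uv by simp
    finally show "\<bar>u * Re x + v * Re y\<bar> + \<bar>u * Im x + v * Im y\<bar> \<le> 1" .
  qed
  moreover have "{z::complex. z ^ 4 = 1} \<subseteq> {z. \<bar>Re z\<bar> + \<bar>Im z\<bar> \<le> 1}"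
  proof clarify
    fix z :: complex assume "z ^ 4 = 1"
    then have "(z - 1) * (z + 1) * ((z - \<i>) * (z + \<i>)) = 0"
      by (simp add: algebra_simps power4_eq_xxxx)
    then have "z = 1 \<or> z = - 1 \<or> z = \<i> \<or> z = - \<i>"
      by (auto simp: eq_neg_iff_add_eq_0)
    then show "\<bar>Re z\<bar> + \<bar>Im z\<bar> \<le> 1" by auto
  qed
  ultimately show "z \<in> Pi_polygon 4 \<Longrightarrow> \<bar>Re z\<bar> + \<bar>Im z\<bar> \<le> 1"
    using hull_minimal unfolding Pi_polygon_def by blast
next
  assume z: "\<bar>Re z\<bar> + \<bar>Im z\<bar> \<le> 1"
  \<comment> \<open>\<open>t\<close> is half of the slack: placed on both \<open>1\<close> and
    \<open>-1\<close>, it cancels in the sum but fills the weights up to total 1. The other weights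
    are the positive and negative parts of the coordinates.\<close>
  define t where "t = (1 - \<bar>Re z\<bar> - \<bar>Im z\<bar>) / 2"
  define c where "c k = [t + max (Re z) 0, max (Im z) 0, t + max (- Re z) 0, max (- Im z) 0] ! k"
    for k
  have "(\<Sum>k<4. c k *\<^sub>R \<i> ^ k) \<in> convex hull {z. z ^ 4 = 1}"
    using z
    by (intro convex_sum convex_convex_hull hull_inc)
      (auto simp: c_def t_def numeral_eq_Suc less_Suc_eq max_def)
  also have "(\<Sum>k<4. c k *\<^sub>R \<i> ^ k) = z"
    by (auto simp: c_def numeral_eq_Suc complex_eq_iff max_def)
  finally show "z \<in> Pi_polygon 4" by (simp add: Pi_polygon_def)
qed

text \<open>Both primitive fourth roots of unity occur as \<open>\<omega>\<close>: conjugation permutes the coefficients.\<close>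

lemma Pi_polygon_4_combination:
  fixes z \<omega> :: complex
  assumes "z \<in> Pi_polygon 4" "\<omega>\<^sup>2 = - 1"
  obtains a b c d :: real where "0 \<le> a" "0 \<le> b" "0 \<le> c" "0 \<le> d" "a + b + c + d = 1"
    "z = a + b * \<omega> - c - d * \<omega>"
proof -
  have z: "\<bar>Re z\<bar> + \<bar>Im z\<bar> \<le> 1" using assms(1) by (simp add: Pi_polygon_4_iff)
  define t where "t = (1 - \<bar>Re z\<bar> - \<bar>Im z\<bar>) / 2"
  have "(\<omega> - \<i>) * (\<omega> + \<i>) = 0"
    using assms(2) by (simp add: algebra_simps power2_eq_square)
  then consider "\<omega> = \<i>" | "\<omega> = - \<i>" by (auto simp: eq_neg_iff_add_eq_0)
  then show thesis
  proof cases
    case 1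
    show ?thesis
      by (rule that[of "t + max (Re z) 0" "max (Im z) 0" "t + max (- Re z) 0" "max (- Im z) 0"])
        (use z in \<open>auto simp: 1 t_def complex_eq_iff max_def field_simps\<close>)
  next
    case 2
    show ?thesis
      by (rule that[of "t + max (Re z) 0" "max (- Im z) 0" "t + max (- Re z) 0" "max (Im z) 0"])
        (use z in \<open>auto simp: 2 t_def complex_eq_iff max_def field_simps\<close>)
  qed
qed

section \<open>Eigenvalues of quaternions and of convolution on the Klein four-group\<close>

text \<open>The roots are \<open>a \<plusminus> \<i> * n\<close>, and the Euclidean norm
  \<open>n\<close> of \<open>(b, c, d)\<close> is at most its l1 norm.\<close>

lemma quaternion_eigenvalue_in_Pi_polygon:
  fixes a b c d :: real and z :: complex
  assumes eq: "(z - a)\<^sup>2 = - (b\<^sup>2 + c\<^sup>2 + d\<^sup>2)" and le: "\<bar>a\<bar> + \<bar>b\<bar> + \<bar>c\<bar> + \<bar>d\<bar> \<le> 1"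
  shows "z \<in> Pi_polygon 4"
proof -
  define n where "n = sqrt (b\<^sup>2 + c\<^sup>2 + d\<^sup>2)"
  have n2: "n\<^sup>2 = b\<^sup>2 + c\<^sup>2 + d\<^sup>2" by (simp add: n_def)
  have "n \<le> \<bar>b\<bar> + \<bar>c\<bar> + \<bar>d\<bar>"
    unfolding n_def
  proof (rule real_le_lsqrt)
    have "(\<bar>b\<bar> + \<bar>c\<bar> + \<bar>d\<bar>)\<^sup>2 = b\<^sup>2 + c\<^sup>2 + d\<^sup>2 + 2 * (\<bar>b\<bar> * \<bar>c\<bar> + \<bar>b\<bar> * \<bar>d\<bar> + \<bar>c\<bar> * \<bar>d\<bar>)"
      by (simp add: power2_eq_square algebra_simps)
    then show "b\<^sup>2 + c\<^sup>2 + d\<^sup>2 \<le> (\<bar>b\<bar> + \<bar>c\<bar> + \<bar>d\<bar>)\<^sup>2" by simp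
  qed simp
  have "(z - a)\<^sup>2 = - complex_of_real (n\<^sup>2)"
    using eq by (simp add: n2)
  then have "(z - a - \<i> * n) * (z - a + \<i> * n) = 0"
    by (simp add: algebra_simps power2_eq_square)
  then have "z - a - \<i> * n = 0 \<or> z - a + \<i> * n = 0"
    by (simp only: mult_eq_0_iff)
  then have "z = Complex a n \<or> z = Complex a (- n)"
    by (auto simp: complex_eq_iff)
  then show ?thesis
    using le \<open>n \<le> \<bar>b\<bar> + \<bar>c\<bar> + \<bar>d\<bar>\<close> by (auto simp: Pi_polygon_4_iff n_def)
qed

text \<open>The right-hand sides are \<open>K x\<close> for a skew matrix \<open>K\<close>,
  multiplication by an imaginary quaternion, with \<open>K^2 = - (b^2 + c^2 + d^2)\<close>. Each
  identity in the proof is a row of \<open>(y^2 - K^2) x = (y + K) ((y - K) x)\<close>, where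
  \<open>(y - K) x\<close> vanishes.\<close>

lemma quaternion_system:
  fixes x1 x2 x3 x4 b c d y :: complex
  assumes "y * x1 = b * x2 + c * x3 + d * x4"
    "y * x2 = - b * x1 + c * x4 - d * x3"
    "y * x3 = - b * x4 - c * x1 + d * x2"
    "y * x4 = b * x3 - c * x2 - d * x1"
    and nz: "x1 \<noteq> 0 \<or> x2 \<noteq> 0 \<or> x3 \<noteq> 0 \<or> x4 \<noteq> 0"
  shows "y\<^sup>2 = - (b\<^sup>2 + c\<^sup>2 + d\<^sup>2)"
proof -
  have "(y\<^sup>2 + (b\<^sup>2 + c\<^sup>2 + d\<^sup>2)) * x1 =
      y * (y * x1 - (b * x2 + c * x3 + d * x4)) + b * (y * x2 - (- b * x1 + c * x4 - d * x3))
      + c * (y * x3 - (- b * x4 - c * x1 + d * x2)) + d * (y * x4 - (b * x3 - c * x2 - d * x1))"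
    by (simp add: power2_eq_square algebra_simps)
  then have "(y\<^sup>2 + (b\<^sup>2 + c\<^sup>2 + d\<^sup>2)) * x1 = 0" using assms(1-4) by simp
  moreover have "(y\<^sup>2 + (b\<^sup>2 + c\<^sup>2 + d\<^sup>2)) * x2 =
      y * (y * x2 - (- b * x1 + c * x4 - d * x3)) - b * (y * x1 - (b * x2 + c * x3 + d * x4))
      + c * (y * x4 - (b * x3 - c * x2 - d * x1)) - d * (y * x3 - (- b * x4 - c * x1 + d * x2))"
    by (simp add: power2_eq_square algebra_simps)
  then have "(y\<^sup>2 + (b\<^sup>2 + c\<^sup>2 + d\<^sup>2)) * x2 = 0" using assms(1-4) by simp
  moreover have "(y\<^sup>2 + (b\<^sup>2 + c\<^sup>2 + d\<^sup>2)) * x3 =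
      y * (y * x3 - (- b * x4 - c * x1 + d * x2)) - b * (y * x4 - (b * x3 - c * x2 - d * x1))
      - c * (y * x1 - (b * x2 + c * x3 + d * x4)) + d * (y * x2 - (- b * x1 + c * x4 - d * x3))"
    by (simp add: power2_eq_square algebra_simps)
  then have "(y\<^sup>2 + (b\<^sup>2 + c\<^sup>2 + d\<^sup>2)) * x3 = 0" using assms(1-4) by simp
  moreover have "(y\<^sup>2 + (b\<^sup>2 + c\<^sup>2 + d\<^sup>2)) * x4 =
      y * (y * x4 - (b * x3 - c * x2 - d * x1)) + b * (y * x3 - (- b * x4 - c * x1 + d * x2))
      - c * (y * x2 - (- b * x1 + c * x4 - d * x3)) - d * (y * x1 - (b * x2 + c * x3 + d * x4))"
    by (simp add: power2_eq_square algebra_simps)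
  then have "(y\<^sup>2 + (b\<^sup>2 + c\<^sup>2 + d\<^sup>2)) * x4 = 0" using assms(1-4) by simp
  ultimately have "y\<^sup>2 + (b\<^sup>2 + c\<^sup>2 + d\<^sup>2) = 0" using nz by auto
  then show ?thesis by (simp only: eq_neg_iff_add_eq_0)
qed

text \<open>This is convolution on the Klein four-group, which its characters diagonalise: the
  pairing of \<open>x\<close> with a character is either zero or forces \<open>z\<close> to be the
  corresponding signed sum.\<close>

lemma klein_four_system:
  fixes x1 x2 x3 x4 a b c d z :: complex
  assumes "z * x1 = a * x1 + b * x2 + c * x3 + d * x4"
    "z * x2 = a * x2 + b * x1 + c * x4 + d * x3"
    "z * x3 = a * x3 + b * x4 + c * x1 + d * x2"
    "z * x4 = a * x4 + b * x3 + c * x2 + d * x1"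
    and nz: "x1 \<noteq> 0 \<or> x2 \<noteq> 0 \<or> x3 \<noteq> 0 \<or> x4 \<noteq> 0"
  shows "z \<in> {a + b + c + d, a + b - c - d, a - b + c - d, a - b - c + d}"
proof (rule ccontr)
  assume contra: "\<not> ?thesis"
  have "(z - (a + b + c + d)) * (x1 + x2 + x3 + x4) = 0"
    using assms(1-4) by (simp add: algebra_simps)
  moreover have "(z - (a + b - c - d)) * (x1 + x2 - x3 - x4) = 0"
    using assms(1-4) by (simp add: algebra_simps)
  moreover have "(z - (a - b + c - d)) * (x1 - x2 + x3 - x4) = 0"
    using assms(1-4) by (simp add: algebra_simps)
  moreover have "(z - (a - b - c + d)) * (x1 - x2 - x3 + x4) = 0"
    using assms(1-4) by (simp add: algebra_simps)
  ultimately have "x1 + x2 + x3 + x4 = 0" "x1 + x2 - x3 - x4 = 0"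
    "x1 - x2 + x3 - x4 = 0" "x1 - x2 - x3 + x4 = 0"
    using contra by auto
  \<comment> \<open>Inverting the character table recovers \<open>x\<close> from the four
    pairings.\<close>
  moreover have "4 * x1 = (x1 + x2 + x3 + x4) + (x1 + x2 - x3 - x4)
      + (x1 - x2 + x3 - x4) + (x1 - x2 - x3 + x4)"
    "4 * x2 = (x1 + x2 + x3 + x4) + (x1 + x2 - x3 - x4)
      - (x1 - x2 + x3 - x4) - (x1 - x2 - x3 + x4)"
    "4 * x3 = (x1 + x2 + x3 + x4) - (x1 + x2 - x3 - x4)
      + (x1 - x2 + x3 - x4) - (x1 - x2 - x3 + x4)"
    "4 * x4 = (x1 + x2 + x3 + x4) - (x1 + x2 - x3 - x4)
      - (x1 - x2 + x3 - x4) + (x1 - x2 - x3 + x4)"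
    by simp_all
  ultimately have "4 * x1 = 0" "4 * x2 = 0" "4 * x3 = 0" "4 * x4 = 0"
    by (simp_all only: add_0_right diff_0_right)
  then show False using nz by simp
qed

section \<open>Convex combinations indexed by a finite set instead of by its image\<close>

text \<open>A combination of images is lifted by choosing one preimage of each. Quantifying over the
  scalar function \<open>\<phi>\<close> covers matrix entries and values of operators at
  once.\<close>

lemma convex_coefficients_pullback:
  fixes c :: "'b \<Rightarrow> real"
  assumes "finite X" "F \<subseteq> \<rho> ` X" "\<forall>A\<in>F. 0 \<le> c A" "sum c F = 1"
  obtains d :: "'a \<Rightarrow> real" where "\<forall>x\<in>X. 0 \<le> d x" "sum d X = 1"
    "\<And>\<phi>. (\<Sum>A\<in>F. complex_of_real (c A) * \<phi> A) = (\<Sum>x\<in>X. complex_of_real (d x) * \<phi> (\<rho> x))"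
proof -
  obtain Y where Y: "Y \<subseteq> X" "inj_on \<rho> Y" "F = \<rho> ` Y"
    using assms(2) by (auto simp: subset_image_inj)
  define d where "d x = (if x \<in> Y then c (\<rho> x) else 0)" for x
  show thesis
  proof
    show "\<forall>x\<in>X. 0 \<le> d x" using assms(3) Y by (auto simp: d_def)
    show "sum d X = 1"
      using assms(1,4) Y by (simp add: d_def sum.If_cases sum.reindex Int_absorb1)
    fix \<phi> :: "'b \<Rightarrow> complex"
    have "(\<Sum>A\<in>F. complex_of_real (c A) * \<phi> A) = (\<Sum>x\<in>Y. complex_of_real (d x) * \<phi> (\<rho> x))"
      using Y by (simp add: d_def sum.reindex)
    also have "\<dots> = (\<Sum>x\<in>X. complex_of_real (d x) * \<phi> (\<rho> x))"
      using assms(1) Y by (intro sum.mono_neutral_left) (auto simp: d_def)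
    finally show "(\<Sum>A\<in>F. complex_of_real (c A) * \<phi> A) =
      (\<Sum>x\<in>X. complex_of_real (d x) * \<phi> (\<rho> x))" .
  qed
qed

text \<open>\<open>\<rho>\<close> may identify points, so the weight of an image is the total weight
  of its fibre.\<close>

lemma convex_coefficients_pushforward:
  fixes d :: "'a \<Rightarrow> real"
  assumes "finite X" "\<forall>x\<in>X. 0 \<le> d x" "sum d X = 1"
  obtains c :: "'b \<Rightarrow> real" where "\<forall>A\<in>\<rho> ` X. 0 \<le> c A" "sum c (\<rho> ` X) = 1"
    "\<And>\<phi>. (\<Sum>A\<in>\<rho> ` X. complex_of_real (c A) * \<phi> A) =
       (\<Sum>x\<in>X. complex_of_real (d x) * \<phi> (\<rho> x))"
proof
  define c where "c A = sum d {x \<in> X. \<rho> x = A}" for A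
  show "\<forall>A\<in>\<rho> ` X. 0 \<le> c A" using assms(2) by (auto simp: c_def intro!: sum_nonneg)
  show "sum c (\<rho> ` X) = 1"
    using assms(1,3) by (simp add: c_def flip: sum.image_gen)
  fix \<phi> :: "'b \<Rightarrow> complex"
  have "(\<Sum>x\<in>X. complex_of_real (d x) * \<phi> (\<rho> x)) =
      (\<Sum>A\<in>\<rho> ` X. \<Sum>x\<in>{x \<in> X. \<rho> x = A}. complex_of_real (d x) * \<phi> (\<rho> x))"
    by (rule sum.image_gen[OF assms(1)])
  also have "\<dots> = (\<Sum>A\<in>\<rho> ` X. complex_of_real (c A) * \<phi> A)"
    by (simp add: c_def sum_distrib_right)
  finally show "(\<Sum>A\<in>\<rho> ` X. complex_of_real (c A) * \<phi> A) =
      (\<Sum>x\<in>X. complex_of_real (d x) * \<phi> (\<rho> x))" by simp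
qed

text \<open>The weights sit on the index set, so coinciding images need no separate treatment; the
  sum is entrywise to match \<open>mat_Co\<close>.\<close>

definition mat_comb :: "nat \<Rightarrow> 'a set \<Rightarrow> ('a \<Rightarrow> complex mat) \<Rightarrow> ('a \<Rightarrow> real) \<Rightarrow> complex mat" where
  "mat_comb n X \<rho> d = mat n n (\<lambda>ij. \<Sum>x\<in>X. complex_of_real (d x) * \<rho> x $$ ij)"

lemma mat_comb_carrier [simp]: "mat_comb n X \<rho> d \<in> carrier_mat n n"
  by (simp add: mat_comb_def)

lemma mat_Co_image:
  assumes "finite X"
  shows "mat_Co n (\<rho> ` X) = {mat_comb n X \<rho> d | d. (\<forall>x\<in>X. 0 \<le> d x) \<and> sum d X = 1}"
proof (intro equalityI subsetI)
  fix M assume "M \<in> mat_Co n (\<rho> ` X)"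
  then obtain F c where M: "M = mat n n (\<lambda>ij. \<Sum>A\<in>F. complex_of_real (c A) * A $$ ij)"
    and F: "F \<subseteq> \<rho> ` X" "\<forall>A\<in>F. 0 \<le> c A" "sum c F = 1"
    unfolding mat_Co_def by blast
  obtain d where d: "\<forall>x\<in>X. 0 \<le> d x" "sum d X = 1"
    "\<And>\<phi>. (\<Sum>A\<in>F. complex_of_real (c A) * \<phi> A) = (\<Sum>x\<in>X. complex_of_real (d x) * \<phi> (\<rho> x))"
    using convex_coefficients_pullback[OF assms F] by blast
  from d(1,2) show "M \<in> {mat_comb n X \<rho> d | d. (\<forall>x\<in>X. 0 \<le> d x) \<and> sum d X = 1}"
    unfolding M mat_comb_def d(3) by blast
next
  fix M assume "M \<in> {mat_comb n X \<rho> d | d. (\<forall>x\<in>X. 0 \<le> d x) \<and> sum d X = 1}"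
  then obtain d where M: "M = mat_comb n X \<rho> d" and d: "\<forall>x\<in>X. 0 \<le> d x" "sum d X = 1"
    by blast
  obtain c where c: "\<forall>A\<in>\<rho> ` X. 0 \<le> c A" "sum c (\<rho> ` X) = 1"
    "\<And>\<phi>. (\<Sum>A\<in>\<rho> ` X. complex_of_real (c A) * \<phi> A) =
       (\<Sum>x\<in>X. complex_of_real (d x) * \<phi> (\<rho> x))"
    using convex_coefficients_pushforward[OF assms d, where \<rho> = \<rho>] by blast
  have "M = mat n n (\<lambda>ij. \<Sum>A\<in>\<rho> ` X. complex_of_real (c A) * A $$ ij)"
    by (simp add: M mat_comb_def c(3))
  with c(1,2) assms show "M \<in> mat_Co n (\<rho> ` X)"
    unfolding mat_Co_def by blast
qed

lemma op_Co_image: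
  assumes "finite X"
  shows "op_Co (\<rho> ` X) =
    {(\<lambda>f y. \<Sum>x\<in>X. complex_of_real (d x) * \<rho> x f y) | d. (\<forall>x\<in>X. 0 \<le> d x) \<and> sum d X = 1}"
    (is "_ = ?R")
proof (intro equalityI subsetI)
  fix M assume "M \<in> op_Co (\<rho> ` X)"
  then obtain F c where M: "M = (\<lambda>f y. \<Sum>A\<in>F. complex_of_real (c A) * A f y)"
    and F: "F \<subseteq> \<rho> ` X" "\<forall>A\<in>F. 0 \<le> c A" "sum c F = 1"
    unfolding op_Co_def by blast
  obtain d where d: "\<forall>x\<in>X. 0 \<le> d x" "sum d X = 1"
    "\<And>\<phi>. (\<Sum>A\<in>F. complex_of_real (c A) * \<phi> A) = (\<Sum>x\<in>X. complex_of_real (d x) * \<phi> (\<rho> x))"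
    using convex_coefficients_pullback[OF assms F] by blast
  have "M = (\<lambda>f y. \<Sum>x\<in>X. complex_of_real (d x) * \<rho> x f y)"
    by (simp add: M d(3))
  with d(1,2) show "M \<in> ?R" by blast
next
  fix M assume "M \<in> ?R"
  then obtain d where M: "M = (\<lambda>f y. \<Sum>x\<in>X. complex_of_real (d x) * \<rho> x f y)"
    and d: "\<forall>x\<in>X. 0 \<le> d x" "sum d X = 1"
    by blast
  obtain c where c: "\<forall>A\<in>\<rho> ` X. 0 \<le> c A" "sum c (\<rho> ` X) = 1"
    "\<And>\<phi>. (\<Sum>A\<in>\<rho> ` X. complex_of_real (c A) * \<phi> A) =
       (\<Sum>x\<in>X. complex_of_real (d x) * \<phi> (\<rho> x))"
    using convex_coefficients_pushforward[OF assms d, where \<rho> = \<rho>] by blast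
  have "M = (\<lambda>f y. \<Sum>A\<in>\<rho> ` X. complex_of_real (c A) * A f y)"
    by (simp add: M c(3))
  with c(1,2) assms show "M \<in> op_Co (\<rho> ` X)"
    unfolding op_Co_def by blast
qed

lemma mat_comb_mult_vec:
  assumes "\<And>x. x \<in> X \<Longrightarrow> \<rho> x \<in> carrier_mat n n" "v \<in> carrier_vec n" "i < n"
  shows "(mat_comb n X \<rho> d *\<^sub>v v) $ i = (\<Sum>x\<in>X. complex_of_real (d x) * (\<rho> x *\<^sub>v v) $ i)"
proof -
  have entry: "(A *\<^sub>v v) $ i = (\<Sum>j<n. A $$ (i, j) * v $ j)" if "A \<in> carrier_mat n n" for A
    using that assms(2,3) by (simp add: scalar_prod_def atLeast0LessThan)
  have "(mat_comb n X \<rho> d *\<^sub>v v) $ i =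
      (\<Sum>j<n. \<Sum>x\<in>X. complex_of_real (d x) * (\<rho> x $$ (i, j) * v $ j))"
    using assms(3) by (simp add: entry, simp add: mat_comb_def sum_distrib_right mult.assoc)
  also have "\<dots> = (\<Sum>x\<in>X. complex_of_real (d x) * (\<rho> x *\<^sub>v v) $ i)"
    using assms(1) by (subst sum.swap) (simp add: entry sum_distrib_left)
  finally show ?thesis .
qed

text \<open>With \<open>B = A\<^sup>2 - 1\<close> one has \<open>(A\<^sup>2 + 1) B = 0\<close>, so nonzero columns of \<open>B\<close> lie in
  the sum of the eigenspaces of \<open>A\<close> for \<open>\<i>\<close> and \<open>- \<i>\<close>.\<close>

lemma eigenvector_of_order_4:
  fixes A :: "complex mat"
  assumes A: "A \<in> carrier_mat n n" and A4: "A * A * (A * A) = 1\<^sub>m n" and A2: "A * A \<noteq> 1\<^sub>m n"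
  obtains \<omega> v where "\<omega>\<^sup>2 = - 1" "v \<in> carrier_vec n" "v \<noteq> 0\<^sub>v n" "A *\<^sub>v v = \<omega> \<cdot>\<^sub>v v"
proof -
  have AA: "A * A \<in> carrier_mat n n" using A by simp
  define B where "B = A * A - 1\<^sub>m n"
  have B: "B \<in> carrier_mat n n" unfolding B_def by (rule minus_carrier_mat) simp
  obtain i j where ij: "i < n" "j < n" "(A * A) $$ (i, j) \<noteq> 1\<^sub>m n $$ (i, j)"
    using A2 AA by (metis carrier_matD eq_matI index_one_mat(2,3))
  define x where "x = col B j"
  have x: "x \<in> carrier_vec n" using B ij by (simp add: x_def)
  have "x $ i \<noteq> 0" using ij B AA by (simp add: x_def, simp add: B_def)
  then have x0: "x \<noteq> 0\<^sub>v n" using ij by auto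
  have "(A * A) * B = - B"
  proof -
    have "(A * A) * B = (A * A) * (A * A) - (A * A) * 1\<^sub>m n"
      unfolding B_def using AA by (intro mult_minus_distrib_mat) auto
    also have "\<dots> = - B"
      unfolding A4 right_mult_one_mat[OF AA] B_def using A by (auto intro!: eq_matI)
    finally show ?thesis .
  qed
  then have "col ((A * A) * B) j = col (- B) j" by simp
  then have AAx: "(A * A) *\<^sub>v x = - x"
    using ij AA B col_mult2[OF AA B ij(2)] by (auto simp: x_def)
  have AAx': "A *\<^sub>v (A *\<^sub>v x) = - x"
    using AAx A x by simp
  have Ax: "A *\<^sub>v x \<in> carrier_vec n" using A x by simp
  \<comment> \<open>On the span of \<open>x\<close> and \<open>A x\<close>, where
    \<open>A * A\<close> is \<open>- 1\<close>, this is twice the projection of \<open>x\<close> to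
    the eigenspace for \<open>\<i>\<close>. If it vanishes, \<open>x\<close> itself is an
    eigenvector for \<open>- \<i>\<close>.\<close>
  define w where "w = x + (- \<i>) \<cdot>\<^sub>v (A *\<^sub>v x)"
  have w: "w \<in> carrier_vec n" using x Ax by (simp add: w_def)
  have "A *\<^sub>v w = A *\<^sub>v x + (- \<i>) \<cdot>\<^sub>v (A *\<^sub>v (A *\<^sub>v x))"
    using A x Ax by (simp add: w_def mult_add_distrib_mat_vec mult_mat_vec)
  also have "\<dots> = \<i> \<cdot>\<^sub>v w"
    unfolding AAx' using A x by (intro eq_vecI) (auto simp: w_def algebra_simps)
  finally have Aw: "A *\<^sub>v w = \<i> \<cdot>\<^sub>v w" .
  show thesis
  proof (cases "w = 0\<^sub>v n")
    case False
    then show ?thesis using that[of \<i>] w Aw by simp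
  next
    case True
    have "A *\<^sub>v x = (- \<i>) \<cdot>\<^sub>v x"
    proof (rule eq_vecI)
      fix k assume "k < dim_vec ((- \<i>) \<cdot>\<^sub>v x)"
      then have k: "k < n" using x by simp
      have "w $ k = 0" using True k by simp
      then have "x $ k = \<i> * (A *\<^sub>v x) $ k" using k A x Ax by (simp add: w_def del: index_mult_mat_vec)
      then show "(A *\<^sub>v x) $ k = ((- \<i>) \<cdot>\<^sub>v x) $ k" using k x by (simp del: index_mult_mat_vec)
    qed (use A x in simp)
    then show ?thesis using that[of "- \<i>"] x x0 by simp
  qed
qed

section \<open>The quaternion group\<close>

text \<open>Kept apart from \<open>quaternion_group\<close>, whose two further facts are proved for
  \<open>Q8\<close> by means of the rewriting derived here.\<close>

locale quaternion_relations = group G for G (structure) +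
  fixes r s
  assumes r_closed [simp]: "r \<in> carrier G" and s_closed [simp]: "s \<in> carrier G"
    and r_pow4: "r \<otimes> (r \<otimes> (r \<otimes> r)) = \<one>"
    and s_square: "s \<otimes> s = r \<otimes> r"
    and conj_r: "inv s \<otimes> (r \<otimes> s) = inv r"
begin

text \<open>The element that plays the role of the quaternion \<open>-1\<close>; it commutes with
  \<open>r\<close> and \<open>s\<close>.\<close>

definition m where "m = r \<otimes> r"

lemma m_in_carrier [simp]: "m \<in> carrier G"
  by (simp add: m_def)

lemma r_r: "r \<otimes> r = m" and s_s: "s \<otimes> s = m"
  by (simp_all add: m_def s_square)

lemma m_m: "m \<otimes> m = \<one>"
  using r_pow4 by (simp add: m_def m_assoc)

lemma r_m: "r \<otimes> m = m \<otimes> r"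
  by (simp add: m_def m_assoc)

lemma s_m: "s \<otimes> m = m \<otimes> s"
  by (simp add: m_assoc flip: s_s)

lemma inv_r: "inv r = m \<otimes> r"
  by (rule inv_equality) (simp_all add: m_assoc r_r m_m)

lemma inv_s: "inv s = m \<otimes> s"
  by (rule inv_equality) (simp_all add: m_assoc s_s m_m)

text \<open>Multiplying the conjugation relation by \<open>s\<close> gives
  \<open>r s = s (inv r)\<close>; here \<open>inv r = m r\<close>, and \<open>m\<close> can be moved
  to the front.\<close>

lemma s_r: "s \<otimes> r = m \<otimes> (r \<otimes> s)"
proof -
  have "r \<otimes> s = s \<otimes> (m \<otimes> r)"
  proof -
    have "s \<otimes> (inv s \<otimes> (r \<otimes> s)) = s \<otimes> (m \<otimes> r)"
      by (simp only: conj_r inv_r)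
    then show ?thesis by (simp flip: m_assoc)
  qed
  also have "\<dots> = m \<otimes> (s \<otimes> r)"
    by (simp add: s_m flip: m_assoc)
  finally have "m \<otimes> (r \<otimes> s) = (m \<otimes> m) \<otimes> (s \<otimes> r)"
    by (simp add: m_assoc)
  then show ?thesis by (simp add: m_m)
qed

text \<open>In a product associated to the right, two adjacent letters are in general followed by a
  tail; these are the same rules with a tail \<open>x\<close>.\<close>

lemma left_absorb:
  assumes "x \<in> carrier G"
  shows "r \<otimes> (r \<otimes> x) = m \<otimes> x" "s \<otimes> (s \<otimes> x) = m \<otimes> x" "m \<otimes> (m \<otimes> x) = x"
    "r \<otimes> (m \<otimes> x) = m \<otimes> (r \<otimes> x)" "s \<otimes> (m \<otimes> x) = m \<otimes> (s \<otimes> x)"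
    "s \<otimes> (r \<otimes> x) = m \<otimes> (r \<otimes> (s \<otimes> x))"
  using assms by (simp_all add: r_r s_s m_m r_m s_m s_r flip: m_assoc)

text \<open>A confluent rewrite system with the normal forms \<open>m\<^sup>a r\<^sup>b s\<^sup>c\<close> for exponents below 2.\<close>

lemmas normalize = m_assoc r_r s_s m_m r_m s_m s_r left_absorb

definition elements where
  "elements = [\<one>, r, s, r \<otimes> s, m, m \<otimes> r, m \<otimes> s, m \<otimes> (r \<otimes> s)]"

lemma elements_closed: "set elements \<subseteq> carrier G"
  by (simp add: elements_def)

text \<open>The induction step for showing that every word in the generators has one of the eight
  normal forms.\<close>

lemma generators_times_elements:
  assumes "x \<in> set elements"
  shows "r \<otimes> x \<in> set elements" "inv r \<otimes> x \<in> set elements"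
    "s \<otimes> x \<in> set elements" "inv s \<otimes> x \<in> set elements"
  using assms by (auto simp: elements_def inv_r inv_s normalize)

end

locale quaternion_group = quaternion_relations +
  assumes carrier_eq: "carrier G = set elements" and distinct_elements: "distinct elements"
begin

lemma finite_carrier: "finite (carrier G)"
  by (simp add: carrier_eq)

lemma sum_carrier:
  "sum h (carrier G) = h \<one> + h r + h s + h (r \<otimes> s) +
     h m + h (m \<otimes> r) + h (m \<otimes> s) + h (m \<otimes> (r \<otimes> s))"
  for h :: "_ \<Rightarrow> 'c::comm_monoid_add"
  unfolding carrier_eq sum.distinct_set_conv_list[OF distinct_elements]
  by (simp add: elements_def add.assoc)

end

section \<open>Quaternions as complex 2 x 2 matrices, and general linear groups\<close>

text \<open>The standard matrix of the quaternion \<open>a + b j\<close> with complex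
  \<open>a\<close> and \<open>b\<close>; multiplication encodes the rule
  \<open>j c = (cnj c) j\<close>.\<close>

definition quat_mat :: "complex \<Rightarrow> complex \<Rightarrow> complex mat" where
  "quat_mat a b = mat 2 2 (\<lambda>(i, j).
     if i = 0 then (if j = 0 then a else b) else (if j = 0 then - cnj b else cnj a))"

lemma quat_mat_carrier [simp]: "quat_mat a b \<in> carrier_mat 2 2"
  by (simp add: quat_mat_def)

lemma quat_mat_mult:
  "quat_mat a b * quat_mat c d = quat_mat (a * c - b * cnj d) (a * d + b * cnj c)"
  by (rule eq_matI)
    (auto simp: quat_mat_def scalar_prod_def numeral_2_eq_2 less_Suc_eq algebra_simps)

lemma quat_mat_one: "quat_mat 1 0 = 1\<^sub>m 2"
  by (rule eq_matI) (auto simp: quat_mat_def numeral_2_eq_2 less_Suc_eq)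

lemma quat_mat_eq_iff: "quat_mat a b = quat_mat c d \<longleftrightarrow> a = c \<and> b = d"
proof
  assume eq: "quat_mat a b = quat_mat c d"
  have "quat_mat a b $$ (0, 0) = quat_mat c d $$ (0, 0)"
    "quat_mat a b $$ (0, 1) = quat_mat c d $$ (0, 1)" using eq by simp_all
  then show "a = c \<and> b = d" by (simp add: quat_mat_def)
qed simp

lemma GL_simps:
  "mult (GL n) = (*)" "one (GL n) = 1\<^sub>m n" "carrier (GL n) \<subseteq> carrier_mat n n"
  by (auto simp: GL_def units_of_def ring_mat_def Units_def)

lemma group_GL: "group (GL n)"
  unfolding GL_def
  by (rule monoid.units_group, rule ring.is_monoid, rule ring_mat)

lemma GL_memberI:
  assumes "A \<in> carrier_mat n n" "B \<in> carrier_mat n n" "A * B = 1\<^sub>m n" "B * A = 1\<^sub>m n"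
  shows "A \<in> carrier (GL n)"
  using assms by (auto simp: GL_def units_of_def ring_mat_def Units_def)

section \<open>Hull spectra of the quaternion group\<close>

context quaternion_group
begin

lemma distinct_cyclic: "distinct [\<one>, r, m, m \<otimes> r]"
  using distinct_elements by (auto simp: elements_def)

text \<open>The odd part \<open>g \<mapsto> f g - f (m \<otimes> g)\<close> carries the quaternionic representation; if it
  vanishes, then \<open>f\<close> descends to the quotient by \<open>m\<close>, a Klein four-group.\<close>

lemma convolution_eigenvalue_in_Pi_polygon:
  fixes f :: "'a \<Rightarrow> complex" and d :: "'a \<Rightarrow> real"
  assumes nonneg: "\<forall>h\<in>carrier G. 0 \<le> d h" and sum1: "sum d (carrier G) = 1"
    and eig: "\<And>g. g \<in> carrier G \<Longrightarrow>
      (\<Sum>h\<in>carrier G. complex_of_real (d h) * f (g \<otimes> h)) = z * f g"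
    and nz: "\<exists>g\<in>carrier G. f g \<noteq> 0"
  shows "z \<in> Pi_polygon 4"
proof -
  have pos: "0 \<le> d \<one>" "0 \<le> d r" "0 \<le> d s" "0 \<le> d (r \<otimes> s)"
    "0 \<le> d m" "0 \<le> d (m \<otimes> r)" "0 \<le> d (m \<otimes> s)" "0 \<le> d (m \<otimes> (r \<otimes> s))"
    using nonneg by auto
  note tot = sum1[unfolded sum_carrier]
  \<comment> \<open>The equation at each of the eight elements, with all products brought to normal
    form: a closed system in the eight values of \<open>f\<close>.\<close>
  note eig' = eig[symmetric, unfolded sum_carrier]
  note eqs = eig'[of "\<one>"] eig'[of r] eig'[of s] eig'[of "r \<otimes> s"]
    eig'[of m] eig'[of "m \<otimes> r"] eig'[of "m \<otimes> s"] eig'[of "m \<otimes> (r \<otimes> s)"]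
  note eqs = eqs[simplified normalize r_closed s_closed m_in_carrier m_closed one_closed
      r_one l_one True_implies_equals]
  define x1 where "x1 = f \<one> - f m"
  define x2 where "x2 = f r - f (m \<otimes> r)"
  define x3 where "x3 = f s - f (m \<otimes> s)"
  define x4 where "x4 = f (r \<otimes> s) - f (m \<otimes> (r \<otimes> s))"
  note x_defs = x1_def x2_def x3_def x4_def
  show ?thesis
  proof (cases "x1 = 0 \<and> x2 = 0 \<and> x3 = 0 \<and> x4 = 0")
    case False
    define a b c e where "a = d \<one> - d m" and "b = d r - d (m \<otimes> r)"
      and "c = d s - d (m \<otimes> s)" and "e = d (r \<otimes> s) - d (m \<otimes> (r \<otimes> s))"
    note abce = a_def b_def c_def e_def
    have "(z - a)\<^sup>2 = - ((complex_of_real b)\<^sup>2 + (complex_of_real c)\<^sup>2 + (complex_of_real e)\<^sup>2)"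
    proof (rule quaternion_system[of "z - a" x1 b x2 c x3 e x4])
      \<comment> \<open>Each of the four equations is the difference of the original ones at
        \<open>g\<close> and at \<open>m \<otimes> g\<close>.\<close>
      show "(z - a) * x1 = b * x2 + c * x3 + e * x4"
        unfolding x_defs abce left_diff_distrib right_diff_distrib eqs(1,5)
        by (simp add: algebra_simps)
      show "(z - a) * x2 = - complex_of_real b * x1 + c * x4 - e * x3"
        unfolding x_defs abce left_diff_distrib right_diff_distrib eqs(2,6)
        by (simp add: algebra_simps)
      show "(z - a) * x3 = - complex_of_real b * x4 - c * x1 + e * x2"
        unfolding x_defs abce left_diff_distrib right_diff_distrib eqs(3,7)
        by (simp add: algebra_simps)
      show "(z - a) * x4 = b * x3 - c * x2 - e * x1"
        unfolding x_defs abce left_diff_distrib right_diff_distrib eqs(4,8)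
        by (simp add: algebra_simps)
    qed (use False in blast)
    \<comment> \<open>Each difference is bounded by the corresponding sum
      \<open>d g + d (m \<otimes> g)\<close>, and all weights add up to 1.\<close>
    moreover have "\<bar>a\<bar> + \<bar>b\<bar> + \<bar>c\<bar> + \<bar>e\<bar> \<le> 1"
      using tot pos unfolding abce by linarith
    ultimately show ?thesis
      by (intro quaternion_eigenvalue_in_Pi_polygon[of z a b c e]) simp_all
  next
    case True
    then have f_m: "f m = f \<one>" "f (m \<otimes> r) = f r" "f (m \<otimes> s) = f s"
      "f (m \<otimes> (r \<otimes> s)) = f (r \<otimes> s)"
      by (simp_all add: x_defs)
    define a b c e where "a = d \<one> + d m" and "b = d r + d (m \<otimes> r)"
      and "c = d s + d (m \<otimes> s)" and "e = d (r \<otimes> s) + d (m \<otimes> (r \<otimes> s))"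
    note abce = a_def b_def c_def e_def
    have "z \<in> {complex_of_real a + b + c + e, complex_of_real a + b - c - e,
      complex_of_real a - b + c - e, complex_of_real a - b - c + e}"
    proof (rule klein_four_system[of z "f \<one>" a b "f r" c "f s" e "f (r \<otimes> s)"])
      show "z * f \<one> = a * f \<one> + b * f r + c * f s + e * f (r \<otimes> s)"
        unfolding abce eqs(1) f_m by (simp add: algebra_simps)
      show "z * f r = a * f r + b * f \<one> + c * f (r \<otimes> s) + e * f s"
        unfolding abce eqs(2) f_m by (simp add: algebra_simps)
      show "z * f s = a * f s + b * f (r \<otimes> s) + c * f \<one> + e * f r"
        unfolding abce eqs(3) f_m by (simp add: algebra_simps)
      show "z * f (r \<otimes> s) = a * f (r \<otimes> s) + b * f s + c * f r + e * f \<one>"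
        unfolding abce eqs(4) f_m by (simp add: algebra_simps)
      show "f \<one> \<noteq> 0 \<or> f r \<noteq> 0 \<or> f s \<noteq> 0 \<or> f (r \<otimes> s) \<noteq> 0"
        using nz by (auto simp: carrier_eq elements_def f_m)
    qed
    \<comment> \<open>The four candidates are signed sums of nonnegative reals of total 1, so
      \<open>z\<close> is real and lies between -1 and 1.\<close>
    moreover have "0 \<le> a" "0 \<le> b" "0 \<le> c" "0 \<le> e" "a + b + c + e = 1"
      using tot pos unfolding abce by linarith+
    ultimately show ?thesis
      by (auto simp: Pi_polygon_4_iff)
  qed
qed

text \<open>The weights live on the powers of \<open>r\<close>, with \<open>m \<otimes> r\<close> as
  the cube. There \<open>\<phi>\<close> takes the values \<open>y\<close>,
  \<open>\<omega> y\<close>, \<open>\<omega>^2 y\<close>, \<open>\<omega>^3 y\<close>, as does a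
  coordinate of \<open>\<rho> x v\<close> when \<open>v\<close> is an eigenvector of
  \<open>\<rho> r\<close> for \<open>\<omega>\<close>.\<close>

lemma cyclic_coefficients:
  assumes "z \<in> Pi_polygon 4" "\<omega>\<^sup>2 = - 1"
  obtains d :: "'a \<Rightarrow> real" where "\<forall>x\<in>carrier G. 0 \<le> d x" "sum d (carrier G) = 1"
    "\<And>\<phi> y. \<phi> \<one> = y \<Longrightarrow> \<phi> r = \<omega> * y \<Longrightarrow> \<phi> m = - y \<Longrightarrow> \<phi> (m \<otimes> r) = - \<omega> * y \<Longrightarrow>
      (\<Sum>x\<in>carrier G. complex_of_real (d x) * \<phi> x) = z * y"
proof -
  obtain a b c e :: real where nonneg: "0 \<le> a" "0 \<le> b" "0 \<le> c" "0 \<le> e"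
    and sum1: "a + b + c + e = 1" and z: "z = a + b * \<omega> - c - e * \<omega>"
    using Pi_polygon_4_combination[OF assms] by blast
  define d where "d x = (if x = \<one> then a else if x = r then b else if x = m then c
    else if x = m \<otimes> r then e else 0)" for x
  have d: "d \<one> = a" "d r = b" "d m = c" "d (m \<otimes> r) = e"
    "d s = 0" "d (r \<otimes> s) = 0" "d (m \<otimes> s) = 0" "d (m \<otimes> (r \<otimes> s)) = 0"
    using distinct_elements by (auto simp: d_def elements_def)
  show thesis
  proof
    show "\<forall>x\<in>carrier G. 0 \<le> d x" using nonneg by (simp add: d_def)
    show "sum d (carrier G) = 1" using sum1 by (simp add: sum_carrier d)
    fix \<phi> :: "'a \<Rightarrow> complex" and y
    assume "\<phi> \<one> = y" "\<phi> r = \<omega> * y" "\<phi> m = - y" "\<phi> (m \<otimes> r) = - \<omega> * y"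
    then show "(\<Sum>x\<in>carrier G. complex_of_real (d x) * \<phi> x) = z * y"
      by (simp add: sum_carrier d z algebra_simps)
  qed
qed

theorem mat_HS_faithful_rep:
  assumes "faithful_rep G n \<rho>"
  shows "mat_HS n (\<rho> ` carrier G) = Pi_polygon 4"
proof (intro equalityI subsetI)
  have hom: "\<rho> \<in> hom G (GL n)" and inj: "inj_on \<rho> (carrier G)"
    using assms by (auto simp: faithful_rep_def)
  have mat: "\<rho> g \<in> carrier_mat n n" if "g \<in> carrier G" for g
    using hom that GL_simps(3) by (auto simp: hom_def)
  have mult: "\<rho> (g \<otimes> h) = \<rho> g * \<rho> h" if "g \<in> carrier G" "h \<in> carrier G" for g h
    using hom that by (simp add: hom_def GL_simps)
  have one: "\<rho> \<one> = 1\<^sub>m n"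
    using hom_one[OF hom is_group group_GL] by (simp add: GL_simps)
  {
    fix z assume "z \<in> mat_HS n (\<rho> ` carrier G)"
    then obtain d v where d: "\<forall>x\<in>carrier G. 0 \<le> d x" "sum d (carrier G) = 1"
      and ev: "eigenvector (mat_comb n (carrier G) \<rho> d) v z"
      by (auto simp: mat_HS_def mat_Co_image[OF finite_carrier] eigenvalue_def)
    define M where "M = mat_comb n (carrier G) \<rho> d"
    have M: "M \<in> carrier_mat n n" by (simp add: M_def)
    have v: "v \<in> carrier_vec n" "v \<noteq> 0\<^sub>v n" "M *\<^sub>v v = z \<cdot>\<^sub>v v"
      using ev by (auto simp: eigenvector_def M_def carrier_matD[OF mat_comb_carrier])
    obtain i where i: "i < n" "v $ i \<noteq> 0"
      using v(1,2) by (metis carrier_vecD eq_vecI index_zero_vec)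
    \<comment> \<open>\<open>f\<close> is a coordinate of the orbit of \<open>v\<close>, chosen to
      be nonzero at \<open>\<one>\<close>.\<close>
    define f where "f g = (\<rho> g *\<^sub>v v) $ i" for g
    show "z \<in> Pi_polygon 4"
    proof (rule convolution_eigenvalue_in_Pi_polygon[OF d])
      have "f \<one> \<noteq> 0" using i v(1) by (simp add: f_def one)
      then show "\<exists>g\<in>carrier G. f g \<noteq> 0" by blast
      fix g assume g: "g \<in> carrier G"
      have entry: "(\<rho> g *\<^sub>v w) $ i = (\<Sum>j<n. \<rho> g $$ (i, j) * w $ j)"
        if "w \<in> carrier_vec n" for w
        using mat[OF g] that i(1) by (simp add: scalar_prod_def atLeast0LessThan)
      have v_car: "\<rho> h *\<^sub>v v \<in> carrier_vec n" if "h \<in> carrier G" for h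
        using mat[OF that] v(1) by simp
      \<comment> \<open>Apply \<open>\<rho> g\<close> to \<open>M v = z v\<close> and expand
        \<open>M\<close>; multiplicativity turns \<open>\<rho> g (\<rho> h v)\<close> into the value
        of \<open>f\<close> at \<open>g \<otimes> h\<close>.\<close>
      have "z * f g = (\<rho> g *\<^sub>v (M *\<^sub>v v)) $ i"
        using mat[OF g] v(1) i(1) unfolding v(3) f_def by (simp add: mult_mat_vec[OF mat[OF g]])
      also have "\<dots> = (\<Sum>j<n. \<rho> g $$ (i, j) * (M *\<^sub>v v) $ j)"
        by (rule entry) (use M v(1) in simp)
      also have "\<dots> = (\<Sum>j<n. \<rho> g $$ (i, j) *
          (\<Sum>h\<in>carrier G. complex_of_real (d h) * (\<rho> h *\<^sub>v v) $ j))"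
        unfolding M_def
        by (intro sum.cong HOL.refl arg_cong2[where f = "(*)"] mat_comb_mult_vec mat v(1)) simp_all
      also have "\<dots> = (\<Sum>h\<in>carrier G. complex_of_real (d h) *
          (\<Sum>j<n. \<rho> g $$ (i, j) * (\<rho> h *\<^sub>v v) $ j))"
        by (simp only: sum_distrib_left, subst sum.swap, simp only: mult.left_commute)
      also have "\<dots> = (\<Sum>h\<in>carrier G. complex_of_real (d h) * f (g \<otimes> h))"
      proof (rule sum.cong[OF HOL.refl])
        fix h assume h: "h \<in> carrier G"
        have "f (g \<otimes> h) = (\<rho> g *\<^sub>v (\<rho> h *\<^sub>v v)) $ i"
          using g h by (simp only: f_def mult assoc_mult_mat_vec[OF mat mat v(1)])
        then show "complex_of_real (d h) * (\<Sum>j<n. \<rho> g $$ (i, j) * (\<rho> h *\<^sub>v v) $ j) =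
            complex_of_real (d h) * f (g \<otimes> h)"
          using entry[OF v_car[OF h]] by simp
      qed
      finally show "(\<Sum>h\<in>carrier G. complex_of_real (d h) * f (g \<otimes> h)) = z * f g" by simp
    qed
  }
  {
    fix z assume z: "z \<in> Pi_polygon 4"
    define A where "A = \<rho> r"
    have A: "A \<in> carrier_mat n n" by (simp add: A_def mat)
    have \<rho>_m: "\<rho> m = A * A" by (simp add: A_def mult flip: r_r)
    have "A * A * (A * A) = 1\<^sub>m n"
      using mult[of m m] by (simp add: m_m one \<rho>_m)
    \<comment> \<open>Faithfulness enters here: \<open>m \<noteq> \<one>\<close> gives
      \<open>\<rho> m \<noteq> \<rho> \<one>\<close>.\<close>
    moreover have "A * A \<noteq> 1\<^sub>m n"
      using inj_onD[OF inj, of m \<one>] distinct_cyclic by (auto simp: \<rho>_m one)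
    ultimately obtain \<omega> v where \<omega>: "\<omega>\<^sup>2 = - 1"
      and v: "v \<in> carrier_vec n" "v \<noteq> 0\<^sub>v n" "A *\<^sub>v v = \<omega> \<cdot>\<^sub>v v"
      using eigenvector_of_order_4[OF A] by blast
    have \<omega>': "\<omega> * (\<omega> * x) = - x" for x
      using \<omega> by (simp add: power2_eq_square flip: mult.assoc)
    have A_m: "(A * A) *\<^sub>v v = - v"
      using A v(1) by (intro eq_vecI) (simp_all add: v(3) mult_mat_vec[OF A] \<omega>' del: index_mult_mat_vec)
    have A_mr: "(A * A * A) *\<^sub>v v = \<omega> \<cdot>\<^sub>v (- v)"
      by (simp only: assoc_mult_mat_vec[OF mult_carrier_mat[OF A A] A v(1)] v(3)
          mult_mat_vec[OF mult_carrier_mat[OF A A] v(1)] A_m)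
    obtain d where d: "\<forall>x\<in>carrier G. 0 \<le> d x" "sum d (carrier G) = 1"
      and comb: "\<And>\<phi> y. \<phi> \<one> = y \<Longrightarrow> \<phi> r = \<omega> * y \<Longrightarrow> \<phi> m = - y \<Longrightarrow> \<phi> (m \<otimes> r) = - \<omega> * y \<Longrightarrow>
        (\<Sum>x\<in>carrier G. complex_of_real (d x) * \<phi> x) = z * y"
      using cyclic_coefficients[OF z \<omega>] by blast
    define M where "M = mat_comb n (carrier G) \<rho> d"
    have M: "M \<in> carrier_mat n n" by (simp add: M_def)
    have "M *\<^sub>v v = z \<cdot>\<^sub>v v"
    proof (rule eq_vecI)
      fix i assume "i < dim_vec (z \<cdot>\<^sub>v v)"
      then have i: "i < n" using v(1) by simp
      have "(M *\<^sub>v v) $ i = (\<Sum>x\<in>carrier G. complex_of_real (d x) * (\<rho> x *\<^sub>v v) $ i)"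
        unfolding M_def by (rule mat_comb_mult_vec) (auto simp: mat v(1) i)
      also have "\<dots> = z * v $ i"
      proof (rule comb)
        show "(\<rho> \<one> *\<^sub>v v) $ i = v $ i" using v(1) by (simp add: one)
        show "(\<rho> r *\<^sub>v v) $ i = \<omega> * v $ i" using v(1) i v(3) by (simp add: A_def del: index_mult_mat_vec)
        show "(\<rho> m *\<^sub>v v) $ i = - v $ i"
          unfolding \<rho>_m A_m using v(1) i by simp
        have "\<rho> (m \<otimes> r) = A * A * A" by (simp add: mult \<rho>_m A_def)
        then show "(\<rho> (m \<otimes> r) *\<^sub>v v) $ i = - \<omega> * v $ i"
          using v(1) i by (simp add: A_mr del: index_mult_mat_vec)
      qed
      finally show "(M *\<^sub>v v) $ i = (z \<cdot>\<^sub>v v) $ i" using i v(1) by simp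
    qed (use M v(1) in simp)
    then have "eigenvalue M z"
      using v M by (auto simp: eigenvalue_def eigenvector_def)
    then show "z \<in> mat_HS n (\<rho> ` carrier G)"
      using d by (auto simp: mat_HS_def mat_Co_image[OF finite_carrier] M_def)
  }
qed

text \<open>The operators act on functions rather than on coordinate vectors, so the two inclusions
  are reduced afresh to the convolution equation and to \<open>cyclic_coefficients\<close>.\<close>

theorem maximal_hull_spectrum_eq: "maximal_hull_spectrum G = Pi_polygon 4"
proof (intro equalityI subsetI)
  fix z assume "z \<in> maximal_hull_spectrum G"
  then obtain d F where d: "\<forall>x\<in>carrier G. 0 \<le> d x" "sum d (carrier G) = 1"
    and F: "F \<in> fun_space (carrier G)" "F \<noteq> (\<lambda>x. 0)"
    and ev: "(\<lambda>y. \<Sum>x\<in>carrier G. complex_of_real (d x) * regular_rep G x F y) = (\<lambda>y. z * F y)"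
    unfolding maximal_hull_spectrum_def op_HS_def op_Co_image[OF finite_carrier] op_eigenvalue_def
    by blast
  show "z \<in> Pi_polygon 4"
  \<comment> \<open>Passing to inverses turns left translation into convolution: \<open>regular_rep
    G h F (inv g) = F (inv h \<otimes> inv g) = F (inv (g \<otimes> h))\<close>.\<close>
  proof (rule convolution_eigenvalue_in_Pi_polygon[OF d, of "\<lambda>g. F (inv g)"])
    obtain y where "F y \<noteq> 0" using F(2) by blast
    moreover from this have "y \<in> carrier G" using F(1) by (auto simp: fun_space_def)
    ultimately show "\<exists>g\<in>carrier G. F (inv g) \<noteq> 0"
      by (intro bexI[of _ "inv y"]) simp_all
  next
    fix g assume g: "g \<in> carrier G"
    have "(\<Sum>h\<in>carrier G. complex_of_real (d h) * F (inv (g \<otimes> h))) =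
        (\<Sum>h\<in>carrier G. complex_of_real (d h) * regular_rep G h F (inv g))"
      using g by (intro sum.cong) (simp_all add: regular_rep_def inv_mult_group)
    also have "\<dots> = z * F (inv g)" using fun_cong[OF ev] .
    finally show "(\<Sum>h\<in>carrier G. complex_of_real (d h) * F (inv (g \<otimes> h))) = z * F (inv g)" .
  qed
next
  fix z assume z: "z \<in> Pi_polygon 4"
  obtain d where d: "\<forall>x\<in>carrier G. 0 \<le> d x" "sum d (carrier G) = 1"
    and comb: "\<And>\<phi> y. \<phi> \<one> = y \<Longrightarrow> \<phi> r = \<i> * y \<Longrightarrow> \<phi> m = - y \<Longrightarrow> \<phi> (m \<otimes> r) = - \<i> * y \<Longrightarrow>
      (\<Sum>x\<in>carrier G. complex_of_real (d x) * \<phi> x) = z * y"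
    using cyclic_coefficients[OF z power2_i] by blast
  \<comment> \<open>\<open>F\<close> sends the \<open>k\<close>-th power of \<open>r\<close> to
    \<open>(- \<i>)^k\<close> and vanishes elsewhere, so left translation by \<open>r\<close>
    multiplies it by \<open>\<i>\<close>.\<close>
  define F where "F x = (if x = \<one> then 1 else if x = r then - \<i> else if x = m then - 1
    else if x = m \<otimes> r then \<i> else 0)" for x
  have F: "F \<one> = 1" "F r = - \<i>" "F m = - 1" "F (m \<otimes> r) = \<i>"
    "F s = 0" "F (r \<otimes> s) = 0" "F (m \<otimes> s) = 0" "F (m \<otimes> (r \<otimes> s)) = 0"
    using distinct_elements by (auto simp: F_def elements_def)
  have F_supp: "F x = 0" if "x \<notin> carrier G" for x
    using that by (auto simp: F_def)
  have inv_m: "inv m = m" and inv_mr: "inv (m \<otimes> r) = r"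
    by (rule inv_equality; simp add: normalize)+
  have "(\<Sum>x\<in>carrier G. complex_of_real (d x) * regular_rep G x F y) = z * F y" for y
  proof (cases "y \<in> carrier G")
    case True
    have "F (m \<otimes> (r \<otimes> y)) = \<i> * F y \<and> F (m \<otimes> y) = - F y \<and> F (r \<otimes> y) = - \<i> * F y"
      using True[unfolded carrier_eq elements_def] by (auto simp: normalize F)
    with True show ?thesis
      by (intro comb) (simp_all add: regular_rep_def inv_m inv_mr inv_r m_assoc)
  qed (simp add: regular_rep_def F_supp)
  then have "op_eigenvalue (carrier G)
      (\<lambda>f y. \<Sum>x\<in>carrier G. complex_of_real (d x) * regular_rep G x f y) z"
    unfolding op_eigenvalue_def using F_supp F(1)
    by (intro bexI[of _ F]) (auto simp: fun_space_def fun_eq_iff intro!: exI[of _ "\<one>"])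
  then show "z \<in> maximal_hull_spectrum G"
    unfolding maximal_hull_spectrum_def op_HS_def op_Co_image[OF finite_carrier]
    using d by blast
qed

end

section \<open>The presented group \<open>Q8\<close> and its eight elements\<close>

definition Q8_rels :: "(Q8_gen gword \<times> Q8_gen gword) set" where
  "Q8_rels =
    {([(Gen_r, True), (Gen_r, True), (Gen_r, True), (Gen_r, True)], []),
     ([(Gen_s, True), (Gen_s, True)], [(Gen_r, True), (Gen_r, True)]),
     ([(Gen_s, False), (Gen_r, True), (Gen_s, True)], [(Gen_r, False)])}"

lemma Q8_eq: "Q8 = presented_group Q8_rels"
  by (simp add: Q8_def Q8_rels_def Let_def)

definition Q8_class :: "Q8_gen gword \<Rightarrow> Q8_gen gword set" where
  "Q8_class u = pres_cong Q8_rels `` {u}"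

lemma Q8_class_closed: "Q8_class u \<in> carrier Q8"
  by (auto simp: Q8_class_def Q8_eq presented_group_def quotient_def)

lemma Q8_class_append: "Q8_class u \<otimes>\<^bsub>Q8\<^esub> Q8_class v = Q8_class (u @ v)"
  by (simp add: Q8_class_def Q8_eq presented_group_mult_class)

lemma Q8_one: "\<one>\<^bsub>Q8\<^esub> = Q8_class []"
  by (simp add: Q8_class_def Q8_eq presented_group_def)

lemma Q8_class_eqI: "(u, v) \<in> pres_cong Q8_rels \<Longrightarrow> Q8_class u = Q8_class v"
  unfolding Q8_class_def by (rule equiv_class_eq[OF equiv_pres_cong])

lemma group_Q8: "group Q8"
  by (simp add: Q8_eq group_presented_group)

lemma Q8_inv_letter: "inv\<^bsub>Q8\<^esub> Q8_class [(a, True)] = Q8_class [(a, False)]"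
proof (rule group.inv_equality[OF group_Q8])
  show "Q8_class [(a, False)] \<otimes>\<^bsub>Q8\<^esub> Q8_class [(a, True)] = \<one>\<^bsub>Q8\<^esub>"
    using pres_cong.cancel[of a False Q8_rels]
    by (simp add: Q8_class_append Q8_one Q8_class_eqI)
qed (rule Q8_class_closed)+

text \<open>The relations hold by construction. This first interpretation provides the list
  \<open>Q8.elements\<close>, in terms of which the order of \<open>Q8\<close> is then
  determined.\<close>

interpretation Q8: quaternion_relations Q8 "Q8_class [(Gen_r, True)]" "Q8_class [(Gen_s, True)]"
proof (intro quaternion_relations.intro quaternion_relations_axioms.intro)
  show "group Q8" by (rule group_Q8)
qed (auto simp: Q8_class_closed Q8_class_append Q8_one Q8_inv_letter Q8_rels_def
      intro!: Q8_class_eqI pres_cong.relation)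

text \<open>The upper bound on the order: prefixing a letter to a word multiplies its class by a
  generator or an inverse, and the list is closed under this.\<close>

lemma Q8_carrier: "carrier Q8 = set Q8.elements"
proof
  show "set Q8.elements \<subseteq> carrier Q8" by (rule Q8.elements_closed)
  have "Q8_class u \<in> set Q8.elements" for u
  proof (induction u)
    case Nil
    show ?case by (simp add: Q8.elements_def flip: Q8_one)
  next
    case (Cons x u)
    obtain a e where x: "x = (a, e)" by (cases x)
    have "Q8_class (x # u) = Q8_class [(a, e)] \<otimes>\<^bsub>Q8\<^esub> Q8_class u"
      by (simp add: Q8_class_append x)
    then show ?case
      using Q8.generators_times_elements[OF Cons] by (cases a; cases e) (auto simp: Q8_inv_letter)
  qed
  then show "carrier Q8 \<subseteq> set Q8.elements"
    by (auto simp: Q8_class_def Q8_eq presented_group_def quotient_def)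
qed

text \<open>The lower bound on the order: the presentation could a priori identify some of the eight
  normal forms, but their images among the unit quaternions differ.\<close>

lemma quaternion_rep_Q8:
  obtains \<phi> where "\<phi> \<in> hom Q8 (GL 2)" "distinct (map \<phi> Q8.elements)"
proof -
  interpret GL: group "GL 2" by (rule group_GL)
  \<comment> \<open>\<open>r\<close> and \<open>s\<close> go to the quaternions \<open>i\<close> and
    \<open>j\<close>.\<close>
  define h where "h a = (case a of Gen_r \<Rightarrow> quat_mat \<i> 0 | Gen_s \<Rightarrow> quat_mat 0 1)" for a
  have mem: "quat_mat \<i> 0 \<in> carrier (GL 2)" "quat_mat (- \<i>) 0 \<in> carrier (GL 2)"
    "quat_mat 0 1 \<in> carrier (GL 2)" "quat_mat 0 (- 1) \<in> carrier (GL 2)"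
    by (rule GL_memberI[where B = "quat_mat (- \<i>) 0"] GL_memberI[where B = "quat_mat \<i> 0"]
        GL_memberI[where B = "quat_mat 0 (- 1)"] GL_memberI[where B = "quat_mat 0 1"],
        simp_all add: quat_mat_mult quat_mat_one)+
  have h: "range h \<subseteq> carrier (GL 2)"
    using mem by (auto simp: h_def split: Q8_gen.split)
  have inv: "inv\<^bsub>GL 2\<^esub> h Gen_r = quat_mat (- \<i>) 0" "inv\<^bsub>GL 2\<^esub> h Gen_s = quat_mat 0 (- 1)"
    by (rule GL.inv_equality; simp add: h_def mem GL_simps(1,2) quat_mat_mult quat_mat_one)+
  have hv: "h Gen_r = quat_mat \<i> 0" "h Gen_s = quat_mat 0 1" by (simp_all add: h_def)
  obtain \<phi> where hom: "\<phi> \<in> hom Q8 (GL 2)" and val: "\<And>u. \<phi> (Q8_class u) = word_eval (GL 2) h u"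
    by (rule GL.presented_group_hom[OF h, where R = Q8_rels])
      (auto simp: Q8_rels_def inv[unfolded hv] hv GL_simps(1,2) quat_mat_mult quat_mat_one[symmetric]
        Q8_eq Q8_class_def)
  have "distinct (map \<phi> Q8.elements)"
    by (simp add: Q8.elements_def Q8.m_def Q8_class_append Q8_one val hv GL_simps(1,2)
        quat_mat_mult quat_mat_one[symmetric] quat_mat_eq_iff complex_eq_iff)
  with hom show thesis using that by blast
qed

interpretation Q8: quaternion_group Q8 "Q8_class [(Gen_r, True)]" "Q8_class [(Gen_s, True)]"
proof
  show "carrier Q8 = set Q8.elements" by (rule Q8_carrier)
  show "distinct Q8.elements" using quaternion_rep_Q8 distinct_map by metis
qed

text \<open>Makes the set of faithful hull spectra nonempty, so that it is a singleton and not
  merely contained in one.\<close>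

lemma faithful_rep_Q8_exists: "\<exists>\<rho>. faithful_rep Q8 2 \<rho>"
  using quaternion_rep_Q8 by (metis Q8_carrier distinct_map faithful_rep_def)

theorem corollary6p3:
  shows "faithful_hull_spectra Q8 = {Pi_polygon 4} \<and> maximal_hull_spectrum Q8 = Pi_polygon 4"
proof
  obtain \<rho> where "faithful_rep Q8 2 \<rho>" using faithful_rep_Q8_exists by blast
  then have "Pi_polygon 4 \<in> faithful_hull_spectra Q8"
    unfolding faithful_hull_spectra_def using Q8.mat_HS_faithful_rep by blast
  then show "faithful_hull_spectra Q8 = {Pi_polygon 4}"
    unfolding faithful_hull_spectra_def using Q8.mat_HS_faithful_rep by blast
  show "maximal_hull_spectrum Q8 = Pi_polygon 4" by (rule Q8.maximal_hull_spectrum_eq)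
qed

end
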